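(* Let $\Bbbk$ be an algebraically closed field of characteristic zero, $q\in\Bbbk^\times$, and $\kappa=(\kappa_1,\kappa_2)\in\mathbb Z^2$. Let $K_{q,\kappa}=K\{q\,x^{1+\kappa_1}y^{1+\kappa_2}\}$. (1) $K_{q,\kappa}$ is isomorphic, as a Poisson field, to either $K_q=K\{qxy\}$, or $K_{\mathrm{Weyl}}=K\{1\}$, or $K_{1,n,0}=K\{x^{n+1}y\}$ for some $n\ge2$. (2) $K_{q,\kappa}$ has a Poisson subfield isomorphic to $K_q$ or $K_{\mathrm{Weyl}}$.
   Context: For $\mathbf f\in\Bbbk(x,y)$, $K\{\mathbf f\}$ denotes the rational function field $\Bbbk(x,y)$ equipped with the unique ($\Bbbk$-bilinear) Poisson bracket such that $\{x,y\}=\mathbf f$; explicitly $\{g,h\}=\left(\frac{\partial g}{\partial x}\frac{\partial h}{\partial y}-\frac{\partial g}{\partial y}\frac{\partial h}{\partial x}\right)\mathbf f$. Isomorphisms of Poisson fields are $\Bbbk$-algebra isomorphisms preserving the Poisson brackets; a Poisson subfield is a subfield containing $\Bbbk$ and closed under the bracket. *)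

theory Defs
  imports "HOL-Computational_Algebra.Computational_Algebra"
begin

section \<open>The rational function field in two variables\<close>

text \<open>
  Polynomials in \<open>x\<close> and \<open>y\<close> are represented as polynomials in \<open>y\<close> (the outer variable)
  whose coefficients are polynomials in \<open>x\<close> (the inner variable).
\<close>

type_synonym 'a ratfun = "'a poly poly fract"

definition rf_const :: "'a::field \<Rightarrow> 'a ratfun" where
  "rf_const c = to_fract [:[:c:]:]"

definition rf_X :: "'a::field ratfun" where
  "rf_X = to_fract [:[:0, 1:]:]"

definition rf_Y :: "'a::field ratfun" where
  "rf_Y = to_fract [:0, 1:]"

lemma map_poly_pderiv_add:
  fixes p q :: "'a::idom poly poly"
  shows "map_poly pderiv (p + q) = map_poly pderiv p + map_poly pderiv q"
  by (rule poly_eqI) (simp add: coeff_map_poly pderiv_add)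

lemma map_poly_pderiv_smult:
  fixes p :: "'a::idom poly poly"
  shows "map_poly pderiv (smult a p) = smult (pderiv a) p + smult a (map_poly pderiv p)"
  by (rule poly_eqI) (simp add: coeff_map_poly pderiv_mult algebra_simps)

lemma map_poly_pderiv_mult:
  fixes p q :: "'a::idom poly poly"
  shows "map_poly pderiv (p * q) = p * map_poly pderiv q + q * map_poly pderiv p"
proof (induction p)
  case (pCons a p)
  then show ?case
    by (simp add: map_poly_pderiv_add map_poly_pderiv_smult map_poly_pCons algebra_simps)
qed simp

lemma quotient_rule_respect:
  fixes D :: "'b::idom \<Rightarrow> 'b"
  assumes D: "\<And>p q. D (p * q) = p * D q + q * D p"
    and eq: "a * d = c * b"
  shows "(D a * b - a * D b) * (d * d) = (D c * d - c * D d) * (b * b)"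
proof -
  have "D (a * d) = D (c * b)" by (simp add: eq)
  then have *: "a * D d + d * D a = c * D b + b * D c" by (simp add: D)
  have "(D a * b - a * D b) * (d * d) - (D c * d - c * D d) * (b * b)
        = b * d * ((a * D d + d * D a) - (c * D b + b * D c))
          - (b * D d + d * D b) * (a * d - c * b)"
    by (simp add: algebra_simps)
  then show ?thesis using * eq by simp
qed

text \<open>
  The quotient rule extending a derivation of an integral domain to its fraction field. For a
  derivation the value does not depend on the chosen representative (\<open>fract_deriv_Fract\<close>).
\<close>

definition fract_deriv :: "('b::idom \<Rightarrow> 'b) \<Rightarrow> 'b fract \<Rightarrow> 'b fract" where
  "fract_deriv D r =
     (let (a, b) = (SOME (a, b). b \<noteq> 0 \<and> r = Fract a b)
      in Fract (D a * b - a * D b) (b * b))"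

lemma fract_deriv_Fract:
  assumes D: "\<And>p q. D (p * q) = p * D q + q * D p" and "b \<noteq> 0"
  shows "fract_deriv D (Fract a b) = Fract (D a * b - a * D b) (b * b)"
proof -
  define P where "P = (\<lambda>(c, d). d \<noteq> 0 \<and> Fract a b = Fract c d)"
  obtain c d where cd: "Eps P = (c, d)" by fastforce
  have "P (a, b)" using \<open>b \<noteq> 0\<close> by (simp add: P_def)
  then have "P (Eps P)" by (rule someI)
  then have *: "d \<noteq> 0" "Fract a b = Fract c d" by (simp_all add: cd) (simp_all add: P_def)
  then have "a * d = c * b" using \<open>b \<noteq> 0\<close> by (simp add: eq_fract)
  from quotient_rule_respect[of D, OF D this] * \<open>b \<noteq> 0\<close>
  show ?thesis
    using cd by (simp add: fract_deriv_def eq_fract(1) flip: P_def)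
qed

definition rf_dx :: "'a::field ratfun \<Rightarrow> 'a ratfun" where
  "rf_dx = fract_deriv (map_poly pderiv)"

definition rf_dy :: "'a::field ratfun \<Rightarrow> 'a ratfun" where
  "rf_dy = fract_deriv pderiv"

section \<open>Poisson structures on the rational function field\<close>

definition rf_bracket :: "'a::field ratfun \<Rightarrow> 'a ratfun \<Rightarrow> 'a ratfun \<Rightarrow> 'a ratfun" where
  "rf_bracket f g h = (rf_dx g * rf_dy h - rf_dy g * rf_dx h) * f"

definition poisson_subfield ::
  "('a::field ratfun \<Rightarrow> 'a ratfun \<Rightarrow> 'a ratfun) \<Rightarrow> 'a ratfun set \<Rightarrow> bool" where
  "poisson_subfield B S \<longleftrightarrow>
     range rf_const \<subseteq> S \<and>
     (\<forall>g\<in>S. \<forall>h\<in>S. g + h \<in> S \<and> g * h \<in> S \<and> B g h \<in> S) \<and>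
     (\<forall>g\<in>S. - g \<in> S \<and> inverse g \<in> S)"

text \<open>
  \<open>poisson_isomorphic S B T C\<close>: the Poisson field \<open>S\<close> with bracket \<open>B\<close> is isomorphic to the
  Poisson field \<open>T\<close> with bracket \<open>C\<close>. It is intended for (Poisson sub)fields \<open>S\<close> and \<open>T\<close>;
  the whole field is \<open>UNIV\<close>.
\<close>

definition poisson_isomorphic ::
  "'a::field ratfun set \<Rightarrow> ('a ratfun \<Rightarrow> 'a ratfun \<Rightarrow> 'a ratfun) \<Rightarrow>
   'a ratfun set \<Rightarrow> ('a ratfun \<Rightarrow> 'a ratfun \<Rightarrow> 'a ratfun) \<Rightarrow> bool" where
  "poisson_isomorphic S B T C \<longleftrightarrow>
     (\<exists>\<phi>. bij_betw \<phi> S T \<and>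
          (\<forall>c. \<phi> (rf_const c) = rf_const c) \<and>
          (\<forall>g\<in>S. \<forall>h\<in>S. \<phi> (g + h) = \<phi> g + \<phi> h \<and> \<phi> (g * h) = \<phi> g * \<phi> h \<and>
                       \<phi> (B g h) = C (\<phi> g) (\<phi> h)))"

section \<open>\<open>rf_bracket f\<close> is the unique Poisson bracket with \<open>{x, y} = f\<close>\<close>

definition poisson_bracket :: "('a::field ratfun \<Rightarrow> 'a ratfun \<Rightarrow> 'a ratfun) \<Rightarrow> bool" where
  "poisson_bracket B \<longleftrightarrow>
     (\<forall>g h k. B (g + h) k = B g k + B h k \<and> B k (g + h) = B k g + B k h) \<and>
     (\<forall>c g h. B (rf_const c * g) h = rf_const c * B g h \<and>
              B g (rf_const c * h) = rf_const c * B g h) \<and>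
     (\<forall>g. B g g = 0) \<and>
     (\<forall>g h k. B g (B h k) + B h (B k g) + B k (B g h) = 0) \<and>
     (\<forall>g h k. B g (h * k) = B g h * k + h * B g k)"

lemma rf_dx_Fract:
  "b \<noteq> 0 \<Longrightarrow> rf_dx (Fract a b) = Fract (map_poly pderiv a * b - a * map_poly pderiv b) (b * b)"
  unfolding rf_dx_def by (rule fract_deriv_Fract[OF map_poly_pderiv_mult])

lemma rf_dy_Fract:
  "b \<noteq> 0 \<Longrightarrow> rf_dy (Fract a b) = Fract (pderiv a * b - a * pderiv b) (b * b)"
  unfolding rf_dy_def by (rule fract_deriv_Fract[OF pderiv_mult])

lemma rf_dx_add: "rf_dx (g + h) = rf_dx g + rf_dx h"
  by (cases g, cases h)
    (simp add: rf_dx_Fract eq_fract map_poly_pderiv_add map_poly_pderiv_mult algebra_simps)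

lemma rf_dy_add: "rf_dy (g + h) = rf_dy g + rf_dy h"
  by (cases g, cases h)
    (simp add: rf_dy_Fract eq_fract pderiv_add pderiv_mult algebra_simps)

lemma rf_dx_mult: "rf_dx (g * h) = rf_dx g * h + g * rf_dx h"
  by (cases g, cases h)
    (simp add: rf_dx_Fract eq_fract map_poly_pderiv_mult algebra_simps)

lemma rf_dy_mult: "rf_dy (g * h) = rf_dy g * h + g * rf_dy h"
  by (cases g, cases h)
    (simp add: rf_dy_Fract eq_fract pderiv_mult algebra_simps)

lemma rf_dx_to_fract: "rf_dx (to_fract p) = to_fract (map_poly pderiv p)"
  by (simp add: to_fract_def rf_dx_Fract map_poly_1)

lemma rf_dy_to_fract: "rf_dy (to_fract p) = to_fract (pderiv p)"
  by (simp add: to_fract_def rf_dy_Fract pderiv_1)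

lemma rf_dx_simps [simp]:
  "rf_dx (rf_const c) = 0" "rf_dx rf_X = 1" "rf_dx rf_Y = 0"
  by (simp_all add: rf_const_def rf_X_def rf_Y_def rf_dx_to_fract map_poly_pCons map_poly_1 pderiv_pCons
      flip: one_pCons)

lemma rf_dy_simps [simp]:
  "rf_dy (rf_const c) = 0" "rf_dy rf_X = 0" "rf_dy rf_Y = 1"
  by (simp_all add: rf_const_def rf_X_def rf_Y_def rf_dy_to_fract pderiv_pCons flip: one_pCons)

lemma derivation_eq_0:
  fixes D :: "'a::field ratfun \<Rightarrow> 'a ratfun"
  assumes add: "\<And>g h. D (g + h) = D g + D h"
    and mult: "\<And>g h. D (g * h) = D g * h + g * D h"
    and const: "\<And>c. D (rf_const c) = 0"
    and X: "D rf_X = 0" and Y: "D rf_Y = 0"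
  shows "D g = 0"
proof -
  have inner: "D (to_fract [:p:]) = 0" for p
  proof (induction p)
    case 0
    then show ?case using const[of 0] by (simp add: rf_const_def)
  next
    case (pCons c p)
    have "[:pCons c p:] = [:[:c:]:] + [:[:0, 1:]:] * [:p:]" by simp
    then have "to_fract [:pCons c p:] = rf_const c + rf_X * to_fract [:p:]"
      by (simp add: rf_const_def rf_X_def flip: to_fract_add to_fract_mult)
    then show ?case by (simp add: add mult const X pCons.IH)
  qed
  have outer: "D (to_fract p) = 0" for p
  proof (induction p)
    case 0
    then show ?case using inner[of 0] by simp
  next
    case (pCons a p)
    have "pCons a p = [:a:] + [:0, 1:] * p" by simp
    then have "to_fract (pCons a p) = to_fract [:a:] + rf_Y * to_fract p"
      by (simp add: rf_Y_def flip: to_fract_add to_fract_mult)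
    then show ?case by (simp add: add mult inner Y pCons.IH)
  qed
  obtain a b where g: "g = Fract a b" "b \<noteq> 0" by (cases g)
  then have "to_fract a = g * to_fract b" by (simp add: to_fract_def eq_fract)
  with mult[of g "to_fract b"] have "D g * to_fract b = 0" by (metis outer mult_zero_right add.right_neutral)
  with g show ?thesis by simp
qed

lemma rf_const_0 [simp]: "rf_const 0 = 0" and rf_const_1 [simp]: "rf_const 1 = 1"
  by (simp_all add: rf_const_def flip: one_pCons)

lemma rf_dx_0 [simp]: "rf_dx 0 = 0" and rf_dy_0 [simp]: "rf_dy 0 = 0"
  using rf_dx_simps(1)[of 0] rf_dy_simps(1)[of 0] by simp_all

lemma rf_dx_1 [simp]: "rf_dx 1 = 0" and rf_dy_1 [simp]: "rf_dy 1 = 0"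
  using rf_dx_simps(1)[of 1] rf_dy_simps(1)[of 1] by simp_all

lemma rf_dx_uminus: "rf_dx (- g) = - rf_dx g"
  using rf_dx_add[of g "- g"] by (simp add: eq_neg_iff_add_eq_0 add.commute)

lemma rf_dy_uminus: "rf_dy (- g) = - rf_dy g"
  using rf_dy_add[of g "- g"] by (simp add: eq_neg_iff_add_eq_0 add.commute)

lemma rf_dx_diff: "rf_dx (g - h) = rf_dx g - rf_dx h"
  using rf_dx_add[of g "- h"] by (simp add: rf_dx_uminus)

lemma rf_dy_diff: "rf_dy (g - h) = rf_dy g - rf_dy h"
  using rf_dy_add[of g "- h"] by (simp add: rf_dy_uminus)

lemma rf_dx_dy_commute: "rf_dx (rf_dy g) = rf_dy (rf_dx g)"
proof -
  have "rf_dx (rf_dy g) - rf_dy (rf_dx g) = 0"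
    by (rule derivation_eq_0[of "\<lambda>g. rf_dx (rf_dy g) - rf_dy (rf_dx g)"])
      (simp_all add: rf_dx_add rf_dy_add rf_dx_mult rf_dy_mult algebra_simps)
  then show ?thesis by simp
qed

lemma derivation_decomp:
  fixes D :: "'a::field ratfun \<Rightarrow> 'a ratfun"
  assumes add: "\<And>g h. D (g + h) = D g + D h"
    and mult: "\<And>g h. D (g * h) = D g * h + g * D h"
    and const: "\<And>c. D (rf_const c) = 0"
  shows "D g = rf_dx g * D rf_X + rf_dy g * D rf_Y"
proof -
  have "D g - (rf_dx g * D rf_X + rf_dy g * D rf_Y) = 0"
    by (rule derivation_eq_0[of "\<lambda>g. D g - (rf_dx g * D rf_X + rf_dy g * D rf_Y)"])
      (simp_all add: rf_dx_add rf_dy_add rf_dx_mult rf_dy_mult add mult const algebra_simps)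
  then show ?thesis by simp
qed

lemma poisson_bracket_rf_bracket: "poisson_bracket (rf_bracket f)"
  unfolding poisson_bracket_def rf_bracket_def
  by (intro conjI allI)
    (simp_all add: rf_dx_add rf_dy_add rf_dx_diff rf_dy_diff rf_dx_mult rf_dy_mult
      rf_dx_dy_commute algebra_simps)

theorem rf_bracket_unique:
  "poisson_bracket B \<and> B rf_X rf_Y = f \<longleftrightarrow> B = rf_bracket f"
proof
  assume asm: "poisson_bracket B \<and> B rf_X rf_Y = f"
  then have B: "poisson_bracket B" and f: "B rf_X rf_Y = f" by auto
  have addL: "B (g + h) k = B g k + B h k" and addR: "B k (g + h) = B k g + B k h"
    and homR: "B g (rf_const c * h) = rf_const c * B g h"
    and alt: "B g g = 0" and Leib: "B g (h * k) = B g h * k + h * B g k" for g h k c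
    using B unfolding poisson_bracket_def by blast+
  have anti: "B h g = - B g h" for g h
    using alt[of "g + h"] unfolding addL addR alt[of g] alt[of h]
    by (simp add: eq_neg_iff_add_eq_0 add.commute)
  have one: "B g 1 = 0" for g
    using Leib[of g 1 1] unfolding mult_1_right mult_1_left by (metis add_cancel_right_right)
  have const: "B g (rf_const c) = 0" for g c
    using homR[of g c 1] by (simp add: one)
  have dec: "B g h = rf_dx h * B g rf_X + rf_dy h * B g rf_Y" for g h
    by (rule derivation_decomp) (simp_all add: addR Leib const)
  show "B = rf_bracket f"
  proof (intro ext)
    fix g h
    have "B g rf_X = - (rf_dy g * f)"
      using anti[of rf_X g] dec[of rf_X g] by (simp add: alt f)
    moreover have "B g rf_Y = rf_dx g * f"
      using anti[of rf_Y g] dec[of rf_Y g] anti[of rf_X rf_Y] by (simp add: alt f)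
    ultimately show "B g h = rf_bracket f g h"
      using dec[of g h] by (simp add: rf_bracket_def algebra_simps)
  qed
next
  assume "B = rf_bracket f"
  then show "poisson_bracket B \<and> B rf_X rf_Y = f"
    using poisson_bracket_rf_bracket by (simp add: rf_bracket_def)
qed

end

theory Submission
  imports Defs
begin

text \<open>
  If \<open>u\<close> and \<open>v\<close> have non-vanishing Jacobian, then \<open>x \<mapsto> u\<close>, \<open>y \<mapsto> v\<close> extends to an embedding
  of \<open>k(x, y)\<close> into itself, and it is Poisson from \<open>K{f}\<close> to \<open>K{g}\<close> as soon as
  \<open>{u, v}\<close> computed in \<open>K{g}\<close> is the image of \<open>f\<close>. All embeddings needed are monomial. For
  \<open>\<kappa> = 0\<close> there is nothing to do. For \<open>\<kappa> \<noteq> 0\<close> let \<open>d = gcd(\<kappa>\<^sub>1, \<kappa>\<^sub>2)\<close>: a unimodular change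
  of exponents sending \<open>\<kappa> / d\<close> to a basis vector gives \<open>K{q x\<^bsup>d+1\<^esup> y}\<close>, where \<open>q\<close> is
  removed by rescaling \<open>x\<close> with a \<open>d\<close>-th root of \<open>q\<close>; for \<open>d = 1\<close> the elements \<open>y\<close> and
  \<open>1 / (x y)\<close> are canonical generators. The Weyl subfield is generated by a pair of
  monomials whose exponents sum to \<open>-\<kappa>\<close> and are linearly independent.
\<close>

section \<open>Embeddings of the rational function field\<close>

lemma rf_const_add: "rf_const (a + b) = rf_const a + rf_const b"
  by (simp add: rf_const_def flip: to_fract_add)

lemma rf_const_mult: "rf_const (a * b) = rf_const a * rf_const b"
  by (simp add: rf_const_def flip: to_fract_mult)

lemma rf_const_minus: "rf_const (- a) = - rf_const a"
  by (simp add: rf_const_def flip: to_fract_uminus)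

lemma rf_const_eq_0_iff [simp]: "rf_const a = 0 \<longleftrightarrow> a = 0"
  by (simp add: rf_const_def)

lemma rf_X_nonzero [simp]: "rf_X \<noteq> 0" and rf_Y_nonzero [simp]: "rf_Y \<noteq> 0"
  by (simp_all add: rf_X_def rf_Y_def)

text \<open>The constants, \<open>x\<close> and \<open>y\<close> generate the field: Horner's scheme
  in each variable reaches every polynomial, and \<open>inverse\<close> then gives the
  fractions.\<close>

lemma ratfun_induct [case_names const X Y add mult inverse]:
  fixes P :: "'a::field ratfun \<Rightarrow> bool"
  assumes const: "\<And>c. P (rf_const c)" and X: "P rf_X" and Y: "P rf_Y"
    and add: "\<And>g h. P g \<Longrightarrow> P h \<Longrightarrow> P (g + h)"
    and mult: "\<And>g h. P g \<Longrightarrow> P h \<Longrightarrow> P (g * h)"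
    and inverse: "\<And>g. P g \<Longrightarrow> P (inverse g)"
  shows "P g"
proof -
  have inner: "P (to_fract [:p:])" for p
  proof (induction p)
    case 0
    then show ?case using const[of 0] by simp
  next
    case (pCons c p)
    have "[:pCons c p:] = [:[:c:]:] + [:[:0, 1:]:] * [:p:]" by simp
    then have "to_fract [:pCons c p:] = rf_const c + rf_X * to_fract [:p:]"
      by (simp add: rf_const_def rf_X_def flip: to_fract_add to_fract_mult)
    then show ?case by (simp add: add mult const X pCons.IH)
  qed
  have outer: "P (to_fract p)" for p
  proof (induction p)
    case 0
    then show ?case using inner[of 0] by simp
  next
    case (pCons a p)
    have "pCons a p = [:a:] + [:0, 1:] * p" by simp
    then have "to_fract (pCons a p) = to_fract [:a:] + rf_Y * to_fract p"
      by (simp add: rf_Y_def flip: to_fract_add to_fract_mult)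
    then show ?case by (simp add: add mult inner Y pCons.IH)
  qed
  obtain a b where g: "g = Fract a b" "b \<noteq> 0" by (cases g)
  then have "g = to_fract a * inverse (to_fract b)" by (simp add: to_fract_def)
  then show ?thesis by (simp add: mult inverse outer)
qed

locale ratfun_embedding =
  fixes \<phi> :: "'a::field ratfun \<Rightarrow> 'a ratfun"
  assumes add: "\<phi> (g + h) = \<phi> g + \<phi> h"
    and mult: "\<phi> (g * h) = \<phi> g * \<phi> h"
    and const [simp]: "\<phi> (rf_const c) = rf_const c"
begin

lemma zero [simp]: "\<phi> 0 = 0" and one [simp]: "\<phi> 1 = 1"
  using const[of 0] const[of 1] by simp_all

lemma minus: "\<phi> (- g) = - \<phi> g"
  using add[of "- g" g] by (simp add: eq_neg_iff_add_eq_0)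

lemma diff: "\<phi> (g - h) = \<phi> g - \<phi> h"
  using add[of g "- h"] by (simp add: minus)

lemma eq_0_iff [simp]: "\<phi> g = 0 \<longleftrightarrow> g = 0"
proof
  assume "\<phi> g = 0"
  show "g = 0"
  proof (rule ccontr)
    assume "g \<noteq> 0"
    then have "\<phi> g * \<phi> (inverse g) = 1" by (simp flip: mult)
    with \<open>\<phi> g = 0\<close> show False by simp
  qed
qed simp

lemma inj: "inj \<phi>"
  by (rule injI) (metis diff eq_0_iff right_minus_eq)

lemma inverse: "\<phi> (inverse g) = inverse (\<phi> g)"
proof (cases "g = 0")
  case False
  then have "\<phi> (inverse g) * \<phi> g = 1" by (simp flip: mult)
  then show ?thesis by (metis inverse_unique inverse_inverse_eq)
qed simp

lemma power: "\<phi> (g ^ n) = \<phi> g ^ n"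
  by (induction n) (simp_all add: mult)

text \<open>The difference \<open>E\<close> of the two sides is a derivation along
  \<open>\<phi>\<close> that vanishes on constants, \<open>x\<close> and \<open>y\<close>, hence
  everywhere.\<close>

lemma derivation_chain_rule:
  assumes D_add: "\<And>g h. D (g + h) = D g + D h"
    and D_mult: "\<And>g h. D (g * h) = D g * h + g * D h"
    and D_const: "\<And>c. D (rf_const c) = 0"
  shows "D (\<phi> g) = \<phi> (rf_dx g) * D (\<phi> rf_X) + \<phi> (rf_dy g) * D (\<phi> rf_Y)"
proof -
  define E where "E g = D (\<phi> g) - (\<phi> (rf_dx g) * D (\<phi> rf_X) + \<phi> (rf_dy g) * D (\<phi> rf_Y))" for g
  have E_mult: "E (g * h) = E g * \<phi> h + \<phi> g * E h" for g h
    by (simp add: E_def mult D_mult rf_dx_mult rf_dy_mult add algebra_simps)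
  have "E g = 0"
  proof (induction g rule: ratfun_induct)
    case (inverse g)
    show ?case
    proof (cases "g = 0")
      case False
      \<comment> \<open>The Leibniz rule for \<open>g * inverse g = 1\<close> leaves
        \<open>\<phi> g * E (inverse g) = 0\<close> with \<open>\<phi> g \<noteq> 0\<close>.\<close>
      have "E 1 = 0" using D_const[of 1] by (simp add: E_def)
      then show ?thesis using E_mult[of g "inverse g"] inverse False by simp
    qed (use inverse in simp)
  qed (simp_all add: E_mult, simp_all add: E_def D_const add D_add rf_dx_add rf_dy_add algebra_simps)
  then show ?thesis by (simp add: E_def)
qed

text \<open>By the chain rule the Jacobian of the images factors as a product of two Jacobians, so
  compatibility on the generators suffices.\<close>

lemma bracket:
  assumes "rf_bracket f (\<phi> rf_X) (\<phi> rf_Y) = \<phi> f'"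
  shows "\<phi> (rf_bracket f' g h) = rf_bracket f (\<phi> g) (\<phi> h)"
proof -
  have dx: "rf_dx (\<phi> g) = \<phi> (rf_dx g) * rf_dx (\<phi> rf_X) + \<phi> (rf_dy g) * rf_dx (\<phi> rf_Y)" for g
    by (rule derivation_chain_rule) (simp_all add: rf_dx_add rf_dx_mult)
  have dy: "rf_dy (\<phi> g) = \<phi> (rf_dx g) * rf_dy (\<phi> rf_X) + \<phi> (rf_dy g) * rf_dy (\<phi> rf_Y)" for g
    by (rule derivation_chain_rule) (simp_all add: rf_dy_add rf_dy_mult)
  have "\<phi> (rf_bracket f' g h) = (\<phi> (rf_dx g) * \<phi> (rf_dy h) - \<phi> (rf_dy g) * \<phi> (rf_dx h)) * \<phi> f'"
    by (simp add: rf_bracket_def mult diff)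
  then show ?thesis
    unfolding assms[symmetric] rf_bracket_def dx[of g] dx[of h] dy[of g] dy[of h]
    by (simp add: algebra_simps)
qed

lemma poisson_subfield_range:
  assumes "rf_bracket f (\<phi> rf_X) (\<phi> rf_Y) = \<phi> f'"
  shows "poisson_subfield (rf_bracket f) (range \<phi>)"
  unfolding poisson_subfield_def
proof (intro conjI ballI)
  show "range rf_const \<subseteq> range \<phi>" by (metis const image_subsetI rangeI)
qed (auto simp flip: add mult minus inverse bracket[OF assms])

lemma poisson_isomorphic_range:
  assumes "rf_bracket f (\<phi> rf_X) (\<phi> rf_Y) = \<phi> f'"
  shows "poisson_isomorphic (range \<phi>) (rf_bracket f) UNIV (rf_bracket f')"
  unfolding poisson_isomorphic_def
proof (intro exI conjI allI ballI)
  \<comment> \<open>The image has to be the source of the isomorphism, so the map is the inverse of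
    \<open>\<phi>\<close>.\<close>
  show "bij_betw (inv \<phi>) (range \<phi>) UNIV"
    using inj by (simp add: bij_betw_inv_into inj_imp_bij_betw_inv)
  show "inv \<phi> (rf_const c) = rf_const c" for c
    using inv_f_f[OF inj, of "rf_const c"] by simp
qed (auto simp: inv_f_f[OF inj] simp flip: add mult bracket[OF assms])

lemma surjI:
  assumes "rf_X \<in> range \<phi>" and "rf_Y \<in> range \<phi>"
  shows "range \<phi> = UNIV"
proof -
  have "g \<in> range \<phi>" for g
  proof (induction g rule: ratfun_induct)
    case (const c)
    show ?case using rangeI[of \<phi> "rf_const c"] by simp
  qed (use assms in \<open>auto simp flip: add mult inverse\<close>)
  then show ?thesis by blast
qed

end

section \<open>Algebraic independence from the Jacobian\<close>

text \<open>
  Substitution in bivariate polynomials is iterated univariate evaluation, so ring homomorphism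
  laws are first shown for one evaluation step with an arbitrary coefficient map.
\<close>

lemma poly_map_poly_hom:
  fixes h :: "'b::comm_ring_1 \<Rightarrow> 'c::comm_ring_1"
  assumes h0: "h 0 = 0" and add: "\<And>a b. h (a + b) = h a + h b"
    and mult: "\<And>a b. h (a * b) = h a * h b"
  shows "poly (map_poly h (p + q)) z = poly (map_poly h p) z + poly (map_poly h q) z"
    and "poly (map_poly h (p * q)) z = poly (map_poly h p) z * poly (map_poly h q) z"
proof -
  have add': "map_poly h (p + q) = map_poly h p + map_poly h q" for p q
    by (rule poly_eqI) (simp add: coeff_map_poly h0 add)
  then show "poly (map_poly h (p + q)) z = poly (map_poly h p) z + poly (map_poly h q) z"
    by simp
  have smult: "map_poly h (smult a p) = smult (h a) (map_poly h p)" for a p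
    by (rule poly_eqI) (simp add: coeff_map_poly h0 mult)
  show "poly (map_poly h (p * q)) z = poly (map_poly h p) z * poly (map_poly h q) z"
    by (induction p) (simp_all add: add' smult map_poly_pCons h0 algebra_simps)
qed

definition inner_subst :: "'a::field ratfun \<Rightarrow> 'a poly \<Rightarrow> 'a ratfun" where
  "inner_subst u p = poly (map_poly rf_const p) u"

definition subst2 :: "'a::field ratfun \<Rightarrow> 'a ratfun \<Rightarrow> 'a poly poly \<Rightarrow> 'a ratfun" where
  "subst2 u v p = poly (map_poly (inner_subst u) p) v"

lemma inner_subst_0 [simp]: "inner_subst u 0 = 0" and inner_subst_1 [simp]: "inner_subst u 1 = 1"
  and inner_subst_pCons [simp]: "inner_subst u (pCons c p) = rf_const c + u * inner_subst u p"
  by (simp_all add: inner_subst_def map_poly_pCons)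

lemma inner_subst_add: "inner_subst u (p + q) = inner_subst u p + inner_subst u q"
  and inner_subst_mult: "inner_subst u (p * q) = inner_subst u p * inner_subst u q"
  unfolding inner_subst_def by (rule poly_map_poly_hom; simp add: rf_const_add rf_const_mult)+

lemma subst2_0 [simp]: "subst2 u v 0 = 0" and subst2_1 [simp]: "subst2 u v 1 = 1"
  and subst2_pCons [simp]: "subst2 u v (pCons a p) = inner_subst u a + v * subst2 u v p"
  by (simp_all add: subst2_def map_poly_pCons)

lemma subst2_add: "subst2 u v (p + q) = subst2 u v p + subst2 u v q"
  and subst2_mult: "subst2 u v (p * q) = subst2 u v p * subst2 u v q"
  unfolding subst2_def by (rule poly_map_poly_hom; simp add: inner_subst_add inner_subst_mult)+

text \<open>The chain rule at the level of polynomials, available before any embedding has been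
  constructed.\<close>

lemma subst2_chain_rule:
  assumes add: "\<And>g h. D (g + h) = D g + D h"
    and mult: "\<And>g h. D (g * h) = D g * h + g * D h"
    and const: "\<And>c. D (rf_const c) = 0"
  shows "D (subst2 u v p) = subst2 u v (map_poly pderiv p) * D u + subst2 u v (pderiv p) * D v"
proof -
  have D0: "D 0 = 0" using const[of 0] by simp
  have inner: "D (inner_subst u a) = inner_subst u (pderiv a) * D u" for a
    by (induction a)
      (simp_all add: D0 add mult const pderiv_pCons inner_subst_add algebra_simps)
  show ?thesis
    by (induction p)
      (simp_all add: D0 add mult inner pderiv_pCons subst2_add map_poly_pCons algebra_simps)
qed

definition jacobian :: "'a::field ratfun \<Rightarrow> 'a ratfun \<Rightarrow> 'a ratfun" where
  "jacobian u v = rf_dx u * rf_dy v - rf_dy u * rf_dx v"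

text \<open>Applying both partial derivatives to the relation gives a homogeneous 2x2 linear system
  whose determinant is the Jacobian.\<close>

lemma subst2_eq_0_derivs:
  assumes J: "jacobian u v \<noteq> 0" and eq: "subst2 u v p = 0"
  shows "subst2 u v (map_poly pderiv p) = 0" and "subst2 u v (pderiv p) = 0"
proof -
  define A B where "A = subst2 u v (map_poly pderiv p)" and "B = subst2 u v (pderiv p)"
  have 1: "A * rf_dx u + B * rf_dx v = 0" and 2: "A * rf_dy u + B * rf_dy v = 0"
    using subst2_chain_rule[of rf_dx u v p] subst2_chain_rule[of rf_dy u v p]
    by (simp_all add: A_def B_def eq rf_dx_add rf_dx_mult rf_dy_add rf_dy_mult)
  \<comment> \<open>Cramer's rule.\<close>
  have "A * jacobian u v = (A * rf_dx u + B * rf_dx v) * rf_dy v - (A * rf_dy u + B * rf_dy v) * rf_dx v"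
    and "B * jacobian u v = (A * rf_dy u + B * rf_dy v) * rf_dx u - (A * rf_dx u + B * rf_dx v) * rf_dy u"
    by (simp_all add: jacobian_def algebra_simps)
  then have "A * jacobian u v = 0" "B * jacobian u v = 0" unfolding 1 2 by simp_all
  then show "A = 0" "B = 0" using J by simp_all
qed

text \<open>Differentiating a polynomial relation of minimal degree produces a smaller one.\<close>

lemma subst2_eq_0_imp:
  fixes p :: "'a::field_char_0 poly poly"
  assumes J: "jacobian u v \<noteq> 0" and eq: "subst2 u v p = 0"
  shows "p = 0"
  using eq
proof (induction "degree p" arbitrary: p rule: less_induct)
  case less
  \<comment> \<open>Relations free of \<open>y\<close> are settled by a separate induction on the
    degree in \<open>x\<close>.\<close>
  have inner: "a = 0" if "subst2 u v [:a:] = 0" for a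
    using that
  proof (induction "degree a" arbitrary: a rule: less_induct)
    case (less a)
    have "subst2 u v [:pderiv a:] = 0"
      using subst2_eq_0_derivs(1)[OF J less.prems] by (simp add: map_poly_pCons)
    then have "pderiv a = 0"
      using less.hyps[of "pderiv a"]
      by (metis degree_pderiv diff_less less_one neq0_conv pderiv_eq_0_iff)
    then obtain c where "a = [:c:]" by (metis degree_eq_zeroE pderiv_eq_0_iff)
    then show ?case using less.prems by simp
  qed
  have "subst2 u v (pderiv p) = 0" by (rule subst2_eq_0_derivs(2)[OF J less.prems])
  \<comment> \<open>In positive degree the derivative is a relation of smaller degree, hence zero by
    induction; in degree zero it vanishes anyway. Either way characteristic zero makes
    \<open>p\<close> constant in \<open>y\<close>.\<close>
  then have "pderiv p = 0"
    using less.hyps[of "pderiv p"]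
    by (metis degree_pderiv diff_less less_one neq0_conv pderiv_eq_0_iff)
  then obtain a where "p = [:a:]" by (metis degree_eq_zeroE pderiv_eq_0_iff)
  then show ?case using less.prems inner by simp
qed

lemma embedding_exists:
  fixes u v :: "'a::field_char_0 ratfun"
  assumes J: "jacobian u v \<noteq> 0"
  obtains \<phi> where "ratfun_embedding \<phi>" "\<phi> rf_X = u" "\<phi> rf_Y = v"
proof -
  \<comment> \<open>The choice ranges over representatives of the fraction; no denominator is sent
    to zero, so the value does not depend on it.\<close>
  define \<phi> where
    "\<phi> r = (SOME z. \<exists>a b. b \<noteq> 0 \<and> r = Fract a b \<and> z = subst2 u v a / subst2 u v b)" for r
  have nz: "subst2 u v b \<noteq> 0" if "b \<noteq> 0" for b
    using subst2_eq_0_imp[OF J] that by blast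
  have \<phi>: "\<phi> (Fract a b) = subst2 u v a / subst2 u v b" if "b \<noteq> 0" for a b
    unfolding \<phi>_def
  proof (rule some_equality)
    show "z = subst2 u v a / subst2 u v b"
      if "\<exists>a' b'. b' \<noteq> 0 \<and> Fract a b = Fract a' b' \<and> z = subst2 u v a' / subst2 u v b'" for z
    proof -
      from that obtain a' b' where *: "b' \<noteq> 0" "Fract a b = Fract a' b'"
        "z = subst2 u v a' / subst2 u v b'" by blast
      then have "subst2 u v (a * b') = subst2 u v (a' * b)"
        using \<open>b \<noteq> 0\<close> by (simp add: eq_fract)
      then show ?thesis
        using nz[OF \<open>b \<noteq> 0\<close>] nz[OF *(1)] *(3) by (simp add: subst2_mult frac_eq_eq)
    qed
  qed (use that in blast)
  have to_fract: "\<phi> (to_fract p) = subst2 u v p" for p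
    using \<phi>[of 1 p] by (simp add: to_fract_def)
  have "ratfun_embedding \<phi>"
  proof
    show "\<phi> (g + h) = \<phi> g + \<phi> h" for g h
      by (cases g, cases h) (simp add: \<phi> nz subst2_add subst2_mult field_simps)
    show "\<phi> (g * h) = \<phi> g * \<phi> h" for g h
      by (cases g, cases h) (simp add: \<phi> nz subst2_mult)
    show "\<phi> (rf_const c) = rf_const c" for c
      unfolding rf_const_def to_fract by (simp add: rf_const_def)
  qed
  moreover have "\<phi> rf_X = u" "\<phi> rf_Y = v"
    unfolding rf_X_def rf_Y_def to_fract by simp_all
  ultimately show thesis using that by blast
qed

text \<open>Lets the bracket computation that is needed anyway also supply the Jacobian
  condition.\<close>

lemma poisson_embedding_exists:
  fixes u v :: "'a::field_char_0 ratfun"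
  assumes "rf_bracket f u v \<noteq> 0"
  obtains \<phi> where "ratfun_embedding \<phi>" "\<phi> rf_X = u" "\<phi> rf_Y = v"
proof -
  have "jacobian u v \<noteq> 0" using assms by (auto simp: rf_bracket_def jacobian_def)
  then show thesis using embedding_exists that by blast
qed

section \<open>Monomials\<close>

definition rf_monom :: "'a::field \<Rightarrow> int \<Rightarrow> int \<Rightarrow> 'a ratfun" where
  "rf_monom c a b = rf_const c * rf_X powi a * rf_Y powi b"

lemma rf_monom_mult: "rf_monom c a b * rf_monom c' a' b' = rf_monom (c * c') (a + a') (b + b')"
  by (simp add: rf_monom_def rf_const_mult power_int_add)

lemma rf_monom_diff: "rf_monom c a b - rf_monom c' a b = rf_monom (c - c') a b"
  using rf_const_add[of c "- c'"]
  by (simp add: rf_monom_def rf_const_minus flip: left_diff_distrib)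

lemma rf_monom_eq_0_iff [simp]: "rf_monom c a b = 0 \<longleftrightarrow> c = 0"
  by (simp add: rf_monom_def)

lemma rf_monom_1: "rf_monom 1 0 0 = 1" and rf_monom_X: "rf_monom 1 1 0 = rf_X"
  and rf_monom_Y: "rf_monom 1 0 1 = rf_Y"
  by (simp_all add: rf_monom_def)

lemma rf_monom_power: "rf_monom c a b ^ n = rf_monom (c ^ n) (int n * a) (int n * b)"
  by (induction n) (simp_all add: rf_monom_1 rf_monom_mult algebra_simps)

lemma rf_monom_inverse: "c \<noteq> 0 \<Longrightarrow> inverse (rf_monom c a b) = rf_monom (inverse c) (- a) (- b)"
  by (rule inverse_unique) (simp add: rf_monom_mult rf_monom_1)

lemma derivation_powi:
  fixes D :: "'b::field \<Rightarrow> 'b"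
  assumes mult: "\<And>g h. D (g * h) = D g * h + g * D h" and "x \<noteq> 0"
  shows "D (x powi n) = of_int n * x powi (n - 1) * D x"
proof -
  have D1: "D 1 = 0"
    using mult[of 1 1] unfolding mult_1_left mult_1_right by (metis add_cancel_right_right)
  \<comment> \<open>Multiplying by \<open>x\<close> avoids the shifted exponent, so the induction
    runs from 0 in both directions.\<close>
  have step: "x * D (x powi n) = of_int n * x powi n * D x"
  proof (induction n rule: int_induct[where k = 0])
    case base
    then show ?case by (simp add: D1)
  next
    case (step1 i)
    have "x powi (i + 1) = x powi i * x" using \<open>x \<noteq> 0\<close> by (simp add: power_int_add)
    then show ?case using step1 by (simp add: mult algebra_simps)
  next
    case (step2 i)
    have *: "x powi i = x powi (i - 1) * x" using \<open>x \<noteq> 0\<close> by (simp add: power_int_diff)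
    with step2 have "x * (x * D (x powi (i - 1))) = x * (of_int (i - 1) * x powi (i - 1) * D x)"
      by (simp add: mult algebra_simps)
    then show ?case using \<open>x \<noteq> 0\<close> by simp
  qed
  then show ?thesis using \<open>x \<noteq> 0\<close> by (simp add: power_int_diff field_simps)
qed

lemma rf_const_of_int: "rf_const (of_int n) = of_int n"
proof -
  have "rf_const (of_nat m) = of_nat m" for m
    by (induction m) (simp_all add: rf_const_add)
  then show ?thesis by (cases n) (simp_all add: rf_const_minus del: of_nat_Suc)
qed

lemma rf_dx_monom: "rf_dx (rf_monom c a b) = rf_monom (c * of_int a) (a - 1) b"
  by (simp add: rf_monom_def rf_dx_mult derivation_powi[of rf_dx] rf_const_mult rf_const_of_int)

lemma rf_dy_monom: "rf_dy (rf_monom c a b) = rf_monom (c * of_int b) a (b - 1)"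
  by (simp add: rf_monom_def rf_dy_mult derivation_powi[of rf_dy] rf_const_mult rf_const_of_int)

text \<open>Reduces all later bracket computations to arithmetic: the coefficient carries the
  determinant of the exponent vectors, and the exponents add up to a shift by one.\<close>

lemma rf_bracket_monom:
  "rf_bracket (rf_monom q s t) (rf_monom c a b) (rf_monom c' a' b') =
   rf_monom (q * c * c' * of_int (a * b' - b * a')) (s + a + a' - 1) (t + b + b' - 1)"
proof -
  have "rf_dx (rf_monom c a b) * rf_dy (rf_monom c' a' b')
      = rf_monom (c * c' * of_int (a * b')) (a + a' - 1) (b + b' - 1)"
    and "rf_dy (rf_monom c a b) * rf_dx (rf_monom c' a' b')
      = rf_monom (c * c' * of_int (b * a')) (a + a' - 1) (b + b' - 1)"
    by (simp_all add: rf_dx_monom rf_dy_monom rf_monom_mult algebra_simps)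
  then show ?thesis
    unfolding rf_bracket_def by (simp add: rf_monom_diff rf_monom_mult algebra_simps)
qed

section \<open>Monomials in the image of an embedding\<close>

context ratfun_embedding
begin

text \<open>The exponents of monic monomials in the image form a subgroup of the integer lattice, by
  products and inverses.\<close>

lemma range_monom_lattice:
  assumes "rf_monom 1 a b \<in> range \<phi>" "rf_monom 1 c e \<in> range \<phi>"
  shows "rf_monom 1 (m * a + n * c) (m * b + n * e) \<in> range \<phi>"
proof -
  have nat_pow: "rf_monom 1 (int k * a) (int k * b) \<in> range \<phi>" if "rf_monom 1 a b \<in> range \<phi>" for k a b
    using that by (auto simp flip: rf_monom_power[of 1, simplified] power)
  have neg: "rf_monom 1 (- a) (- b) \<in> range \<phi>" if "rf_monom 1 a b \<in> range \<phi>" for a b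
    using that by (auto simp flip: rf_monom_inverse[of 1, simplified] inverse)
  have pow: "rf_monom 1 (k * a) (k * b) \<in> range \<phi>" if "rf_monom 1 a b \<in> range \<phi>" for k a b
    using nat_pow[OF that] neg[OF nat_pow[OF that]] by (cases k) (simp_all del: of_nat_Suc)
  have "rf_monom 1 (m * a) (m * b) * rf_monom 1 (n * c) (n * e) \<in> range \<phi>"
    using pow[OF assms(1), of m] pow[OF assms(2), of n] by (auto simp flip: mult)
  then show ?thesis by (simp add: rf_monom_mult)
qed

lemma range_monom_coeff:
  assumes "rf_monom k a b \<in> range \<phi>" "k \<noteq> 0"
  shows "rf_monom 1 a b \<in> range \<phi>"
proof -
  obtain g where g: "rf_monom k a b = \<phi> g" using assms by blast
  have "rf_monom 1 a b = rf_const (inverse k) * rf_monom k a b"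
    using assms(2) by (simp add: rf_monom_def flip: mult.assoc rf_const_mult)
  also have "\<dots> = \<phi> (rf_const (inverse k) * g)" by (simp add: mult g)
  finally show ?thesis by simp
qed

text \<open>Determinant 1 makes the two exponent vectors a basis of the lattice, so \<open>x\<close>
  and \<open>y\<close> lie in the image.\<close>

lemma unimodular_surj:
  assumes X: "\<phi> rf_X = rf_monom k a b" and Y: "\<phi> rf_Y = rf_monom l c e"
    and "k \<noteq> 0" "l \<noteq> 0" and det: "a * e - b * c = 1"
  shows "range \<phi> = UNIV"
proof (rule surjI)
  have 1: "rf_monom 1 a b \<in> range \<phi>" by (rule range_monom_coeff[OF _ \<open>k \<noteq> 0\<close>]) (simp flip: X)
  have 2: "rf_monom 1 c e \<in> range \<phi>" by (rule range_monom_coeff[OF _ \<open>l \<noteq> 0\<close>]) (simp flip: Y)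
  \<comment> \<open>The rows \<open>(e, -b)\<close> and \<open>(-c, a)\<close> of the inverse matrix
    express the standard basis vectors.\<close>
  have "e * a + - b * c = 1" "e * b + - b * e = 0" "- c * a + a * c = 0" "- c * b + a * e = 1"
    using det by (simp_all add: algebra_simps)
  then show "rf_X \<in> range \<phi>" "rf_Y \<in> range \<phi>"
    using range_monom_lattice[OF 1 2, of e "- b"] range_monom_lattice[OF 1 2, of "- c" a]
    by (simp_all only: rf_monom_X rf_monom_Y)
qed

end

section \<open>Monomial Poisson structures\<close>

lemma poisson_isomorphic_refl: "poisson_isomorphic UNIV B UNIV B"
  unfolding poisson_isomorphic_def by (rule exI[of _ id]) auto

text \<open>Bezout coefficients complete the primitive vector \<open>(k, l) / gcd k l\<close> to a
  unimodular matrix.\<close>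

lemma bezout_det:
  fixes k l :: int
  assumes "(k, l) \<noteq> (0, 0)"
  obtains a b c e where "k = gcd k l * a" "l = gcd k l * b" "a * e - b * c = 1"
proof -
  let ?d = "gcd k l"
  have "?d \<noteq> 0" using assms by auto
  obtain e c where ec: "e * k + c * l = ?d" using bezout_int by blast
  obtain a b where ab: "k = ?d * a" "l = ?d * b" by (meson dvdE gcd_dvd1 gcd_dvd2)
  have "?d * (a * e - b * (- c)) = ?d * a * e + ?d * b * c" by (simp add: algebra_simps)
  also have "\<dots> = ?d" using ec ab by (simp add: mult.commute)
  finally have "a * e - b * (- c) = 1" using \<open>?d \<noteq> 0\<close> by (metis mult_cancel_left2)
  with ab show thesis using that by blast
qed

lemma weyl_isomorphic:
  fixes q :: "'a::field_char_0"
  assumes "q \<noteq> 0" and det: "k * e - l * c = 1"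
  shows "poisson_isomorphic UNIV (rf_bracket (rf_monom q (1 + k) (1 + l))) UNIV (rf_bracket 1)"
proof -
  \<comment> \<open>The exponents sum to \<open>(-k, -l)\<close>, which makes the bracket constant,
    and their determinant is again 1; \<open>inverse q\<close> normalizes it.\<close>
  let ?u = "rf_monom 1 c e" and ?v = "rf_monom (inverse q) (- c - k) (- e - l)"
  have "c * (- e - l) - e * (- c - k) = 1" using det by (simp add: algebra_simps)
  then have br: "rf_bracket (rf_monom q (1 + k) (1 + l)) ?u ?v = 1"
    using \<open>q \<noteq> 0\<close> by (simp add: rf_bracket_monom rf_monom_1)
  then obtain \<phi> where "ratfun_embedding \<phi>" and XY: "\<phi> rf_X = ?u" "\<phi> rf_Y = ?v"
    using poisson_embedding_exists by (metis zero_neq_one)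
  then interpret ratfun_embedding \<phi> by simp
  have "range \<phi> = UNIV"
    by (rule unimodular_surj[OF XY]) (use assms in \<open>simp_all add: algebra_simps\<close>)
  then show ?thesis using poisson_isomorphic_range[of _ 1] br by (simp add: XY)
qed

lemma power_isomorphic:
  fixes q :: "'a::{alg_closed_field, field_char_0}"
  assumes "q \<noteq> 0" and "n > 0" and det: "a * e - b * c = 1"
  shows "poisson_isomorphic UNIV (rf_bracket (rf_monom q (1 + int n * a) (1 + int n * b)))
           UNIV (rf_bracket (rf_X ^ (n + 1) * rf_Y))"
proof -
  \<comment> \<open>The bracket of \<open>?u\<close> and \<open>?v\<close> has coefficient
    \<open>q * r\<close>, while \<open>?u ^ (n + 1) * ?v\<close> has
    \<open>r ^ (n + 1)\<close>.\<close>
  obtain r where r: "r ^ n = q" using nth_root_exists \<open>n > 0\<close> by blast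
  with assms have "r \<noteq> 0" by auto
  let ?f = "rf_monom q (1 + int n * a) (1 + int n * b)"
  let ?u = "rf_monom r a b" and ?v = "rf_monom 1 c e"
  have br: "rf_bracket ?f ?u ?v = ?u ^ (n + 1) * ?v"
    unfolding rf_bracket_monom rf_monom_power rf_monom_mult det
    by (simp add: r algebra_simps)
  then have "rf_bracket ?f ?u ?v \<noteq> 0" using \<open>r \<noteq> 0\<close> by simp
  then obtain \<phi> where "ratfun_embedding \<phi>" and XY: "\<phi> rf_X = ?u" "\<phi> rf_Y = ?v"
    using poisson_embedding_exists by metis
  then interpret ratfun_embedding \<phi> by simp
  have "range \<phi> = UNIV"
    by (rule unimodular_surj[OF XY]) (use \<open>r \<noteq> 0\<close> det in simp_all)
  moreover have "rf_bracket ?f (\<phi> rf_X) (\<phi> rf_Y) = \<phi> (rf_X ^ (n + 1) * rf_Y)"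
    using br by (simp only: XY mult power)
  ultimately show ?thesis using poisson_isomorphic_range by metis
qed

lemma weyl_subfield:
  fixes q :: "'a::field_char_0"
  assumes "q \<noteq> 0" and "(k, l) \<noteq> (0, 0)"
  obtains S where "poisson_subfield (rf_bracket (rf_monom q (1 + k) (1 + l))) S"
    "poisson_isomorphic S (rf_bracket (rf_monom q (1 + k) (1 + l))) UNIV (rf_bracket 1)"
proof -
  let ?f = "rf_monom q (1 + k) (1 + l)"
  define m where "m = k * k + l * l"
  have "m \<noteq> 0" using assms(2) by (auto simp: m_def sum_squares_eq_zero_iff)
  \<comment> \<open>The vector \<open>(-l, k)\<close> is \<open>(k, l)\<close> turned by a right
    angle; completing it to the sum \<open>(-k, -l)\<close> gives determinant \<open>m\<close>, the
    squared length of \<open>(k, l)\<close>. It may exceed 1, so surjectivity is not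
    claimed.\<close>
  let ?u = "rf_monom (inverse (q * of_int m)) (- l) k" and ?v = "rf_monom 1 (l - k) (- k - l)"
  have "(- l) * (- k - l) - k * (l - k) = m" by (simp add: m_def algebra_simps)
  moreover have "q * inverse (q * of_int m) * 1 * of_int m = 1"
    using \<open>q \<noteq> 0\<close> \<open>m \<noteq> 0\<close> by (simp add: field_simps)
  ultimately have br: "rf_bracket ?f ?u ?v = 1"
    by (simp add: rf_bracket_monom del: of_int_mult of_int_diff) (simp add: rf_monom_1)
  then obtain \<phi> where "ratfun_embedding \<phi>" and XY: "\<phi> rf_X = ?u" "\<phi> rf_Y = ?v"
    using poisson_embedding_exists by (metis zero_neq_one)
  then interpret ratfun_embedding \<phi> by simp
  have "rf_bracket ?f (\<phi> rf_X) (\<phi> rf_Y) = \<phi> 1" using br by (simp add: XY)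
  then show thesis using that poisson_subfield_range poisson_isomorphic_range by blast
qed

theorem corollary4p2:
  fixes q :: "'a::{alg_closed_field, field_char_0}" and \<kappa>1 \<kappa>2 :: int
  assumes "q \<noteq> 0"
  defines "K_q\<kappa> \<equiv> rf_bracket (rf_const q * rf_X powi (1 + \<kappa>1) * rf_Y powi (1 + \<kappa>2))"
    and "K_q \<equiv> rf_bracket (rf_const q * rf_X * rf_Y)"
    and "K_Weyl \<equiv> rf_bracket (1 :: 'a ratfun)"
    and "K_1n0 \<equiv> (\<lambda>n::nat. rf_bracket ((rf_X :: 'a ratfun) ^ (n + 1) * rf_Y))"
  shows "(poisson_isomorphic UNIV K_q\<kappa> UNIV K_q \<or>
          poisson_isomorphic UNIV K_q\<kappa> UNIV K_Weyl \<or>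
          (\<exists>n\<ge>2. poisson_isomorphic UNIV K_q\<kappa> UNIV (K_1n0 n)))
       \<and> (\<exists>S. poisson_subfield K_q\<kappa> S \<and>
              (poisson_isomorphic S K_q\<kappa> UNIV K_q \<or>
               poisson_isomorphic S K_q\<kappa> UNIV K_Weyl))"
proof (cases "(\<kappa>1, \<kappa>2) = (0, 0)")
  case True
  then have "K_q\<kappa> = K_q" by (simp add: K_q\<kappa>_def K_q_def)
  \<comment> \<open>For \<open>\<kappa> = 0\<close> the whole field serves as the subfield.\<close>
  moreover have "poisson_subfield K_q UNIV" by (simp add: poisson_subfield_def)
  ultimately show ?thesis using poisson_isomorphic_refl by blast
next
  case False
  have K: "K_q\<kappa> = rf_bracket (rf_monom q (1 + \<kappa>1) (1 + \<kappa>2))"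
    by (simp add: K_q\<kappa>_def rf_monom_def)
  define n where "n = nat (gcd \<kappa>1 \<kappa>2)"
  have n: "gcd \<kappa>1 \<kappa>2 = int n" by (simp add: n_def)
  have "n > 0" using False n by (metis gcd_eq_0_iff gr0I of_nat_0)
  obtain a b c e where ab: "\<kappa>1 = int n * a" "\<kappa>2 = int n * b" and det: "a * e - b * c = 1"
    using bezout_det[OF False] unfolding n by metis
  have "poisson_isomorphic UNIV K_q\<kappa> UNIV K_Weyl \<or>
      (\<exists>n\<ge>2. poisson_isomorphic UNIV K_q\<kappa> UNIV (K_1n0 n))"
  \<comment> \<open>For \<open>n = 1\<close> the vector \<open>(\<kappa>1, \<kappa>2)\<close> is
    itself primitive, which is the Weyl case.\<close>
  proof (cases "n = 1")
    case True
    then have "\<kappa>1 * e - \<kappa>2 * c = 1" using ab det by simp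
    then show ?thesis
      using weyl_isomorphic[OF \<open>q \<noteq> 0\<close>] unfolding K K_Weyl_def by blast
  next
    case False
    with \<open>n > 0\<close> have "n \<ge> 2" by simp
    moreover have "poisson_isomorphic UNIV K_q\<kappa> UNIV (K_1n0 n)"
      unfolding K K_1n0_def ab by (rule power_isomorphic[OF \<open>q \<noteq> 0\<close> \<open>n > 0\<close> det])
    ultimately show ?thesis by blast
  qed
  moreover have "\<exists>S. poisson_subfield K_q\<kappa> S \<and> poisson_isomorphic S K_q\<kappa> UNIV K_Weyl"
    using weyl_subfield[OF \<open>q \<noteq> 0\<close> False] unfolding K K_Weyl_def by blast
  ultimately show ?thesis by blast
qed

end
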